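(* Let $m,n,q\geq 1$ be integers and let $d=m+n+q-1$. If $$-dn^2+4dm+4dn-4m^2-4mn-4d+4m>0,$$ then the sign pattern $\Sigma_{m,n,q}$ is realizable with the pair $(0,d-2)$.
   Context: A sign pattern of length $d+1$ is a sequence of $d+1$ signs $+$ or $-$ beginning with a $+$. A real polynomial $P=x^d+a_{d-1}x^{d-1}+\cdots+a_1x+a_0$ with all $a_j\neq 0$ defines the sign pattern $(+,\mathrm{sgn}(a_{d-1}),\ldots,\mathrm{sgn}(a_1),\mathrm{sgn}(a_0))$. For integers $m,n,q\geq 1$ with $m+n+q=d+1$, $\Sigma_{m,n,q}$ denotes the sign pattern consisting of $m$ pluses followed by $n$ minuses followed by $q$ pluses. A sign pattern is realizable with a pair $(pos,neg)$ if there is a monic real polynomial of degree $d$ defining this sign pattern which has exactly $pos$ positive roots, all distinct (simple), and exactly $neg$ negative roots, all distinct (simple); the remaining roots are non-real. *)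

theory Defs
  imports Complex_Main "HOL-Computational_Algebra.Polynomial"
begin

text \<open>
  Signs are the values \<open>1\<close> and \<open>-1\<close> of the function \<^const>\<open>sgn\<close>; the sign of the leading
  coefficient comes first.
\<close>

definition sign_pattern :: "real list \<Rightarrow> bool" where
  "sign_pattern \<sigma> \<longleftrightarrow> \<sigma> \<noteq> [] \<and> set \<sigma> \<subseteq> {1, -1} \<and> hd \<sigma> = 1"

definition Sigma_pattern :: "nat \<Rightarrow> nat \<Rightarrow> nat \<Rightarrow> real list" where
  "Sigma_pattern m n q = replicate m 1 @ replicate n (-1) @ replicate q 1"

text \<open>\<^const>\<open>coeffs\<close> lists the coefficients from the constant term upwards, hence the reversal.\<close>

definition defines_sign_pattern :: "real poly \<Rightarrow> real list \<Rightarrow> bool" where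
  "defines_sign_pattern P \<sigma> \<longleftrightarrow>
     lead_coeff P = 1 \<and> (\<forall>j\<le>degree P. coeff P j \<noteq> 0) \<and> \<sigma> = map sgn (rev (coeffs P))"

text \<open>
  In the following definition, the root \<open>0\<close> is excluded because the constant coefficient is
  nonzero, so all roots that are not counted are non-real.
\<close>

definition realizable :: "real list \<Rightarrow> nat \<Rightarrow> nat \<Rightarrow> bool" where
  "realizable \<sigma> p r \<longleftrightarrow> sign_pattern \<sigma> \<and>
     (\<exists>P :: real poly. degree P + 1 = length \<sigma> \<and> defines_sign_pattern P \<sigma> \<and>
        card {x. 0 < x \<and> poly P x = 0} = p \<and>
        card {x. x < 0 \<and> poly P x = 0} = r \<and>
        (\<forall>x. poly P x = 0 \<longrightarrow> order x P = 1))"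

end

theory Submission
  imports Defs
begin

text \<open>
  In \<open>(x + 1) ^ (d - 2) * (x\<^sup>2 + a * x + b)\<close> the coefficient of \<open>x ^ (d - k)\<close> is \<open>d choose k\<close> times a
  quadratic polynomial in \<open>k\<close>, and any two numbers \<open>u, v\<close> can be prescribed as its roots by the
  choice of \<open>a\<close> and \<open>b\<close>.  The sign pattern appears for \<open>u\<close> slightly below \<open>m\<close> and \<open>v\<close> slightly above
  \<open>m + n - 1\<close>, and in the limit \<open>u = m\<close>, \<open>v = m + n - 1\<close> the hypothesis says exactly that
  \<open>x\<^sup>2 + a * x + b\<close> has negative discriminant.  Finally the root \<open>-1\<close> is split into the simple roots
  \<open>- (1 + t * i)\<close> for a small \<open>t > 0\<close>, which does not affect the signs of the coefficients.
\<close>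

section \<open>Coefficients of a power of \<open>x + 1\<close> times a quadratic\<close>

text \<open>With \<open>j = N + 2 - k\<close>, the coefficient is \<open>b\<close> times
  \<open>N choose j\<close> plus \<open>a\<close> times \<open>N choose (j - 1)\<close> plus
  \<open>N choose (j - 2)\<close>. Each of these is a rational multiple of
  \<open>N + 2 choose j\<close>, and the factor \<open>(N + 2) * (N + 1)\<close> clears the
  denominators.\<close>

lemma coeff_one_plus_X_power_mult_quadratic:
  fixes a b :: real
  assumes "k \<le> N + 2"
  shows "real (N + 2) * real (N + 1) * coeff ([:1, 1:] ^ N * [:b, a, 1:]) (N + 2 - k) =
    real (N + 2 choose k) *
      (b * real k * (real k - 1) + a * real k * (real (N + 2) - real k)
        + (real (N + 2) - real k) * (real (N + 2) - real k - 1))"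
proof -
  define j where "j = N + 2 - k"
  have k: "k = N + 2 - j" and j: "j \<le> N + 2"
    using assms by (auto simp: j_def)
  have sym: "N + 2 choose k = N + 2 choose j"
    using assms unfolding j_def by (rule binomial_symmetric)
  have rk: "real k = real N + 2 - real j"
    using j by (simp add: k of_nat_diff)
  have up: "real (Suc M choose i) * (real (Suc M) - real i) = real (Suc M) * real (M choose i)" for M i
  proof (cases "i \<le> Suc M")
    case True
    have "real ((Suc M - i) * (Suc M choose i)) = real (Suc M * (M choose i))"
      by (simp add: binomial_absorb_comp del: of_nat_mult binomial_Suc_Suc)
    with True show ?thesis
      by (simp only: of_nat_mult of_nat_diff mult.commute)
  qed (simp add: binomial_eq_0)
  have absorb: "real (Suc M choose Suc i) * real (Suc i) = real (Suc M) * real (M choose i)" for M i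
    using Suc_times_binomial[of i M] by (metis mult.commute of_nat_mult)
  define p where "p = [:1, 1::real:] ^ N"
  have p: "coeff p i = real (N choose i)" for i
    by (cases "i \<le> N") (simp_all add: p_def coeff_linear_poly_power binomial_eq_0 coeff_eq_0 degree_linear_power)
  define C where "C = real (N + 2 choose j)"
  \<comment> \<open>Going from \<open>N + 2\<close> down to \<open>N\<close> takes two binomial
    identities: \<open>up\<close> keeps the lower index, \<open>absorb\<close> lowers it by one.
    Hence \<open>c0\<close> uses \<open>up\<close> twice, \<open>c1\<close> uses each once, and
    \<open>c2\<close> uses \<open>absorb\<close> twice.\<close>
  have c0: "C * real k * (real k - 1) = real (N + 2) * real (N + 1) * real (N choose j)"
    using up[of "Suc N" j] up[of N j] unfolding C_def rk by (simp add: algebra_simps)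
  have c1: "C * real j * real k = real (N + 2) * real (N + 1) * (if j = 0 then 0 else real (N choose (j - 1)))"
  proof (cases j)
    case (Suc i)
    have "C * real j = real (N + 2) * real (Suc N choose i)"
      using absorb[of "Suc N" i] by (simp add: C_def Suc del: binomial_Suc_Suc)
    moreover have "real k = real (Suc N) - real i"
      by (simp add: rk Suc)
    ultimately have "C * real j * real k = real (N + 2) * (real (Suc N choose i) * (real (Suc N) - real i))"
      by (simp only: mult.assoc)
    then show ?thesis
      by (simp add: up Suc del: of_nat_Suc)
  qed simp
  have c2: "C * real j * (real j - 1) =
      real (N + 2) * real (N + 1) * (if j < 2 then 0 else real (N choose (j - 2)))"
  \<comment> \<open>The default 0 for a missing binomial coefficient is right because
    \<open>j * (j - 1)\<close> vanishes for \<open>j < 2\<close>.\<close>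
  proof (cases "j < 2")
    case True
    then have "j = 0 \<or> j = 1" by auto
    then show ?thesis by auto
  next
    case False
    then obtain i where j2: "j = Suc (Suc i)" by (metis add_2_eq_Suc le_Suc_ex not_less)
    have "C * real j = real (N + 2) * real (Suc N choose Suc i)"
      using absorb[of "Suc N" "Suc i"] by (simp add: C_def j2 del: binomial_Suc_Suc)
    moreover have "real j - 1 = real (Suc i)"
      by (simp add: j2)
    ultimately have "C * real j * (real j - 1) = real (N + 2) * (real (Suc N choose Suc i) * real (Suc i))"
      by (simp only: mult.assoc)
    then show ?thesis
      by (simp add: absorb j2 del: of_nat_Suc binomial_Suc_Suc)
  qed
  have "p * [:b, a, 1:] = smult b p + pCons 0 (smult a p + pCons 0 p)"
    by (simp add: mult.commute[of p])
  then have co: "coeff (p * [:b, a, 1:]) j = b * real (N choose j)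
      + a * (if j = 0 then 0 else real (N choose (j - 1))) + (if j < 2 then 0 else real (N choose (j - 2)))"
    by (auto simp: p coeff_pCons split: nat.splits)
  have "real (N + 2) * real (N + 1) * coeff (p * [:b, a, 1:]) j
      = b * (C * real k * (real k - 1)) + a * (C * real j * real k) + C * real j * (real j - 1)"
    unfolding co c0 c1 c2 by (simp add: algebra_simps)
  also have "real j = real (N + 2) - real k"
    by (simp add: rk)
  finally show ?thesis
    unfolding p_def j_def[symmetric] sym C_def by (simp add: algebra_simps)
qed

section \<open>Continuity in the parameters, and the quadratic factor\<close>

text \<open>A further linear factor combines only the coefficients \<open>j\<close> and
  \<open>j - 1\<close>, so induction on \<open>N\<close> works for all \<open>j\<close> at
  once.\<close>

lemma isCont_coeff_prod_linear:
  fixes c :: "nat \<Rightarrow> real"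
  shows "isCont (\<lambda>t. coeff (\<Prod>i<N. [:1 + t * c i, 1:]) j) t0"
proof (induction N arbitrary: j)
  case (Suc N)
  show ?case
  proof (cases j)
    case 0
    then show ?thesis using Suc[of 0] by (auto intro!: continuous_intros)
  next
    case (Suc j')
    then show ?thesis using Suc.IH[of j] Suc.IH[of j'] by (auto intro!: continuous_intros)
  qed
qed simp

text \<open>A strict inequality at \<open>e = 0\<close> persists for small \<open>e > 0\<close> by
  continuity. The shift moves the roots of the quadratic in \<open>k\<close> off the integers, so
  that no coefficient vanishes.\<close>

lemma exists_spread_preserving_discriminant:
  fixes M L D :: real
  assumes "D * (4 * M * L - (M + L - 1)\<^sup>2) - 4 * M * L > 0"
  obtains e where "0 < e" "e < 1"
    "D * (4 * (M - e) * (L + e) - ((M - e) + (L + e) - 1)\<^sup>2) - 4 * (M - e) * (L + e) > 0"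
proof -
  let ?F = "\<lambda>e. D * (4 * (M - e) * (L + e) - ((M - e) + (L + e) - 1)\<^sup>2) - 4 * (M - e) * (L + e)"
  have "(?F \<longlongrightarrow> ?F 0) (at_right 0)"
    by (intro tendsto_intros)
  moreover have "?F 0 > 0"
    using assms by simp
  ultimately have "\<forall>\<^sub>F e in at_right 0. ?F e > 0"
    by (rule order_tendstoD(1))
  moreover have "\<forall>\<^sub>F e::real in at_right 0. e \<in> {0<..<1}"
    by (rule eventually_at_right_real) simp
  ultimately have "\<forall>\<^sub>F e in at_right 0. ?F e > 0 \<and> e \<in> {0<..<1}"
    by eventually_elim simp
  from eventually_happens'[OF _ this] obtain e where "?F e > 0" "e \<in> {0<..<1}"
    by auto
  then show thesis by (intro that[of e]) auto
qed

text \<open>The three parameters come from comparing both sides of the first identity: the value at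
  \<open>x = 0\<close> gives \<open>c\<close>, the value at \<open>x = D\<close> gives
  \<open>b\<close>, and the leading coefficient \<open>b - a + 1 = c\<close> gives
  \<open>a\<close>.\<close>

lemma coeff_quadratic_factorization:
  fixes a b c u v D x :: real
  assumes "u \<noteq> 0" "v \<noteq> 0"
    and c: "c = D * (D - 1) / (u * v)"
    and b: "b = (D - u) * (D - v) / (u * v)"
    and a: "a = 1 + b - c"
  shows "b * x * (x - 1) + a * x * (D - x) + (D - x) * (D - x - 1) = c * (x - u) * (x - v)"
    and "(u * v)\<^sup>2 * (4 * b - a\<^sup>2) = D * (D * (4 * u * v - (u + v - 1)\<^sup>2) - 4 * u * v)"
proof -
  have uv: "u * v \<noteq> 0" using assms by simp
  \<comment> \<open>After multiplication by \<open>u * v\<close> both claims become polynomial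
    identities in \<open>u\<close>, \<open>v\<close>, \<open>D\<close> and \<open>x\<close>.\<close>
  have cuv: "c * (u * v) = D * (D - 1)" and buv: "b * (u * v) = (D - u) * (D - v)"
    using uv by (simp_all add: c b)
  have auv: "a * (u * v) = u * v + (D - u) * (D - v) - D * (D - 1)"
    unfolding a by (simp add: distrib_right left_diff_distrib cuv buv)
  have "(b * x * (x - 1) + a * x * (D - x) + (D - x) * (D - x - 1)) * (u * v)
      = (b * (u * v)) * x * (x - 1) + (a * (u * v)) * x * (D - x) + (D - x) * (D - x - 1) * (u * v)"
    by (simp add: algebra_simps)
  also have "\<dots> = (c * (u * v)) * (x - u) * (x - v)"
    unfolding auv buv cuv by (simp add: algebra_simps)
  also have "\<dots> = (c * (x - u) * (x - v)) * (u * v)"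
    by (simp add: algebra_simps)
  finally show "b * x * (x - 1) + a * x * (D - x) + (D - x) * (D - x - 1) = c * (x - u) * (x - v)"
    using uv by simp
  have "(u * v)\<^sup>2 * (4 * b - a\<^sup>2) = 4 * (b * (u * v)) * (u * v) - (a * (u * v))\<^sup>2"
    by (simp add: algebra_simps power2_eq_square)
  also have "\<dots> = D * (D * (4 * u * v - (u + v - 1)\<^sup>2) - 4 * u * v)"
    unfolding auv buv by (simp add: algebra_simps power2_eq_square)
  finally show "(u * v)\<^sup>2 * (4 * b - a\<^sup>2) = D * (D * (4 * u * v - (u + v - 1)\<^sup>2) - 4 * u * v)" .
qed

section \<open>Sign patterns and simple roots\<close>

lemma nth_Sigma_pattern:
  assumes "k < m + n + q"
  shows "Sigma_pattern m n q ! k = (if m \<le> k \<and> k < m + n then -1 else 1)"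
  using assms by (auto simp: Sigma_pattern_def nth_append)

lemma length_Sigma_pattern [simp]: "length (Sigma_pattern m n q) = m + n + q"
  by (simp add: Sigma_pattern_def)

lemma sign_pattern_Sigma_pattern: "m \<ge> 1 \<Longrightarrow> sign_pattern (Sigma_pattern m n q)"
  by (cases m) (auto simp: sign_pattern_def Sigma_pattern_def)

text \<open>Replaces the reversed coefficient list by an index: entry \<open>k\<close> belongs to
  the power \<open>degree P - k\<close>. Since \<open>\<sigma>\<close> has no zero entry, the sign
  condition already forces every coefficient to be nonzero.\<close>

lemma defines_sign_patternI:
  assumes "lead_coeff P = 1" and "length \<sigma> = degree P + 1"
    and sgn: "\<And>k. k \<le> degree P \<Longrightarrow> sgn (coeff P (degree P - k)) = \<sigma> ! k"
    and nz: "0 \<notin> set \<sigma>"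
  shows "defines_sign_pattern P \<sigma>"
proof -
  have "P \<noteq> 0" using assms(1) by auto
  then have len: "length (coeffs P) = degree P + 1"
    by (simp add: length_coeffs_degree)
  have "coeff P j \<noteq> 0" if "j \<le> degree P" for j
  proof
    assume "coeff P j = 0"
    then have "\<sigma> ! (degree P - j) = 0"
      using sgn[of "degree P - j"] that by simp
    moreover have "degree P - j < length \<sigma>"
      using assms(2) by simp
    ultimately show False
      using nz nth_mem by metis
  qed
  moreover have "\<sigma> = map sgn (rev (coeffs P))"
  proof (rule nth_equalityI)
    show "length \<sigma> = length (map sgn (rev (coeffs P)))"
      using assms(2) len by simp
    fix k assume "k < length \<sigma>"
    then have "k \<le> degree P" using assms(2) by simp
    then show "\<sigma> ! k = map sgn (rev (coeffs P)) ! k"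
      using sgn[of k] len \<open>P \<noteq> 0\<close> by (simp add: rev_nth coeffs_nth)
  qed
  ultimately show ?thesis
    using assms(1) by (simp add: defines_sign_pattern_def)
qed

text \<open>Once the factor for \<open>r i\<close> is split off, the cofactor does not vanish at
  \<open>r i\<close>, by injectivity and the assumption on \<open>R\<close>; orders add under
  multiplication.\<close>

lemma order_prod_distinct_linear_mult:
  fixes r :: "nat \<Rightarrow> real"
  assumes "inj_on r {..<N}" and "i < N" and "poly R (r i) \<noteq> 0"
  shows "order (r i) ((\<Prod>i<N. [:- r i, 1:]) * R) = 1"
proof -
  define S where "S = (\<Prod>l\<in>{..<N} - {i}. [:- r l, 1:]) * R"
  have eq: "(\<Prod>i<N. [:- r i, 1:]) * R = [:- r i, 1:] * S"
    unfolding S_def using assms(2)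
    by (subst prod.remove[of _ i]) (simp_all only: finite_lessThan lessThan_iff mult.assoc)
  have "poly S (r i) \<noteq> 0"
    using assms by (auto simp: S_def poly_prod inj_on_def)
  then have "order (r i) S = 0" and "S \<noteq> 0"
    by (auto intro: order_0I)
  then have "[:- r i, 1:] * S \<noteq> 0"
    by (metis mult_eq_0_iff pCons_eq_0_iff zero_neq_one)
  then show ?thesis
    using \<open>order (r i) S = 0\<close> order_power_n_n[of "r i" 1] unfolding eq by (subst order_mult) auto
qed

section \<open>Construction of the realizing polynomial\<close>

theorem theorem2:
  fixes m n q d :: nat
  assumes "m \<ge> 1" and "n \<ge> 1" and "q \<ge> 1"
    and "d = m + n + q - 1"
    and "- int d * (int n)^2 + 4 * int d * int m + 4 * int d * int n - 4 * (int m)^2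
           - 4 * int m * int n - 4 * int d + 4 * int m > 0"
  shows "realizable (Sigma_pattern m n q) 0 (d - 2)"
proof -
  define N where "N = d - 2"
  \<comment> \<open>As \<open>m + n + q\<close> is at least 3, neither natural subtraction is
    truncated.\<close>
  have d: "d = N + 2" and d': "d + 1 = m + n + q"
    using assms(1-4) by (auto simp: N_def)
  define M L D where "M = real m" and "L = real m + real n - 1" and "D = real d"
  have "0 < real_of_int (- int d * (int n)^2 + 4 * int d * int m + 4 * int d * int n - 4 * (int m)^2
           - 4 * int m * int n - 4 * int d + 4 * int m)"
    using assms(5) by (simp only: of_int_0_less_iff)
  also have "\<dots> = D * (4 * M * L - (M + L - 1)\<^sup>2) - 4 * M * L"
    by (simp add: M_def L_def D_def algebra_simps power2_eq_square)
  finally obtain e where e: "0 < e" "e < 1"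
    and disc: "D * (4 * (M - e) * (L + e) - ((M - e) + (L + e) - 1)\<^sup>2) - 4 * (M - e) * (L + e) > 0"
    by (rule exists_spread_preserving_discriminant)
  \<comment> \<open>Thus \<open>u\<close> lies strictly between \<open>m - 1\<close> and
    \<open>m\<close>, and \<open>v\<close> strictly between \<open>m + n - 1\<close> and
    \<open>m + n\<close>.\<close>
  define u v where "u = M - e" and "v = L + e"
  define c where "c = D * (D - 1) / (u * v)"
  define b where "b = (D - u) * (D - v) / (u * v)"
  define a where "a = 1 + b - c"
  have D: "D \<ge> 2" using d by (simp add: D_def)
  have u: "u > 0" and v: "v > 0"
    using e assms(1,2) by (auto simp: u_def v_def M_def L_def)
  then have "c > 0" using D by (simp add: c_def)
  note quad = coeff_quadratic_factorization[OF _ _ c_def b_def a_def]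
  have "(u * v)\<^sup>2 * (4 * b - a\<^sup>2) > 0"
    using quad(2) u v disc D unfolding u_def[symmetric] v_def[symmetric] by simp
  then have ab: "a\<^sup>2 < 4 * b"
    by (simp add: zero_less_mult_iff)
  define R where "R = [:b, a, 1:]"
  have R: "poly R x > 0" for x
  proof -
    \<comment> \<open>Completing the square turns the negative discriminant into positivity.\<close>
    have "poly R x = (x + a / 2)\<^sup>2 + (4 * b - a\<^sup>2) / 4"
      by (simp add: R_def field_simps power2_eq_square)
    with ab show ?thesis by (simp add: add_nonneg_pos)
  qed
  \<comment> \<open>At \<open>t = 0\<close> this is \<open>[:1, 1:] ^ N * R\<close>, to which the
    coefficient formula applies; for \<open>t > 0\<close> the linear factors are distinct.\<close>
  define P where "P = (\<lambda>t. (\<Prod>i<N. [:1 + t * real i, 1:]) * R)"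
  have sgn0: "sgn (coeff (P 0) (d - k)) = Sigma_pattern m n q ! k" if "k \<le> d" for k
  proof -
    have "D * (D - 1) * coeff (P 0) (d - k) = real (d choose k) * (c * (real k - u) * (real k - v))"
      using coeff_one_plus_X_power_mult_quadratic[of k N b a] that u v quad(1)[of "real k"]
      by (simp add: P_def R_def d D_def)
    then have "sgn (D * (D - 1) * coeff (P 0) (d - k)) =
        sgn (real (d choose k) * (c * (real k - u) * (real k - v)))"
      by simp
    \<comment> \<open>The factors \<open>D * (D - 1)\<close>, \<open>d choose k\<close> and
      \<open>c\<close> are positive, so only the position of \<open>k\<close> relative to
      \<open>u\<close> and \<open>v\<close> matters.\<close>
    then have "sgn (coeff (P 0) (d - k)) = sgn (real k - u) * sgn (real k - v)"
      using D \<open>c > 0\<close> that by (simp add: sgn_mult)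
    also have "\<dots> = (if m \<le> k \<and> k < m + n then -1 else 1)"
    proof -
      consider "k + 1 \<le> m" | "m \<le> k" "k + 1 \<le> m + n" | "m + n \<le> k" by linarith
      then show ?thesis
      proof cases
        case 1
        then have "real k + 1 \<le> real m" by linarith
        then show ?thesis using 1 e assms(2) by (simp add: u_def v_def M_def L_def)
      next
        case 2
        then have "real m \<le> real k" "real k + 1 \<le> real m + real n" by linarith+
        then show ?thesis using 2 e by (simp add: u_def v_def M_def L_def)
      next
        case 3
        then have "real m + real n \<le> real k" by linarith
        then show ?thesis using 3 e assms(2) by (simp add: u_def v_def M_def L_def)
      qed
    qed
    finally show ?thesis
      using that d' by (simp add: nth_Sigma_pattern)
  qed
  have nz: "0 \<notin> set (Sigma_pattern m n q)"
    by (auto simp: Sigma_pattern_def)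
  have sgn_nz: "Sigma_pattern m n q ! k \<noteq> 0" if "k \<le> d" for k
    using that d' by (simp add: nth_Sigma_pattern)
  have "isCont (\<lambda>t. coeff (P t) j) 0" for j
    unfolding P_def coeff_mult by (intro continuous_intros isCont_coeff_prod_linear)
  then have lim: "((\<lambda>t. coeff (P t) j) \<longlongrightarrow> coeff (P 0) j) (at_right 0)" for j
    by (meson isContD filterlim_at_split)
  \<comment> \<open>Every coefficient of \<open>P 0\<close> is nonzero, so by continuity it keeps
    its sign for small \<open>t\<close>; as there are finitely many \<open>k\<close>, one
    \<open>t\<close> serves them all.\<close>
  have "\<forall>\<^sub>F t in at_right 0. sgn (coeff (P t) (d - k)) = Sigma_pattern m n q ! k" if "k \<le> d" for k
  proof (cases "coeff (P 0) (d - k) > 0")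
    case True
    from order_tendstoD(1)[OF lim True] show ?thesis
      by eventually_elim (use True sgn0[OF that] in simp)
  next
    case False
    with sgn0[OF that] sgn_nz[OF that] have neg: "coeff (P 0) (d - k) < 0"
      by (metis linorder_less_linear sgn_0)
    from order_tendstoD(2)[OF lim neg] show ?thesis
      by eventually_elim (use neg sgn0[OF that] in simp)
  qed
  then have "\<forall>\<^sub>F t in at_right 0. \<forall>k\<in>{..d}. sgn (coeff (P t) (d - k)) = Sigma_pattern m n q ! k"
    by (intro eventually_ball_finite) auto
  moreover have "\<forall>\<^sub>F t::real in at_right 0. t > 0"
    by (rule eventually_at_right_less)
  ultimately have "\<forall>\<^sub>F t in at_right 0. t > 0 \<and>
      (\<forall>k\<in>{..d}. sgn (coeff (P t) (d - k)) = Sigma_pattern m n q ! k)"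
    by eventually_elim simp
  from eventually_happens'[OF _ this] obtain t where t: "t > 0"
    and sgn: "\<And>k. k \<le> d \<Longrightarrow> sgn (coeff (P t) (d - k)) = Sigma_pattern m n q ! k"
    by auto
  define r where "r = (\<lambda>i. - (1 + t * real i))"
  have Pt: "P t = (\<Prod>i<N. [:- r i, 1:]) * R"
    by (simp add: P_def r_def add.commute)
  have inj: "inj_on r A" for A
    using t by (auto simp: r_def inj_on_def)
  have rneg: "r i < 0" for i
  proof -
    have "t * real i \<ge> 0" using t by simp
    then show ?thesis by (simp add: r_def)
  qed
  have R_deg: "degree R = 2" and R_lead: "lead_coeff R = 1" and "R \<noteq> 0"
    by (simp_all add: R_def)
  have deg: "degree (P t) = d"
    using \<open>R \<noteq> 0\<close> unfolding Pt d
    by (subst degree_mult_eq) (auto simp: degree_prod_sum_eq R_deg)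
  have lead: "lead_coeff (P t) = 1"
    unfolding Pt by (simp add: lead_coeff_mult lead_coeff_prod R_lead)
  \<comment> \<open>Since \<open>R\<close> is positive everywhere, the real roots are exactly the
    \<open>N\<close> numbers \<open>r i\<close>, all negative and, because \<open>t > 0\<close>,
    distinct.\<close>
  have root: "poly (P t) x = 0 \<longleftrightarrow> x \<in> r ` {..<N}" for x
    using R[of x] by (auto simp: Pt poly_prod)
  have "{x. 0 < x \<and> poly (P t) x = 0} = {}"
    using rneg by (auto simp: root dest: less_asym)
  then have pos: "card {x. 0 < x \<and> poly (P t) x = 0} = 0"
    by (simp only: card.empty)
  have "{x. x < 0 \<and> poly (P t) x = 0} = r ` {..<N}"
    using rneg by (auto simp: root)
  then have neg: "card {x. x < 0 \<and> poly (P t) x = 0} = d - 2"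
    using inj by (simp add: card_image d)
  have "order x (P t) = 1" if "poly (P t) x = 0" for x
  proof -
    from that obtain i where i: "i < N" "x = r i"
      by (auto simp: root)
    have "poly R (r i) \<noteq> 0"
      using R[of "r i"] by simp
    then show ?thesis
      unfolding Pt i(2) using inj i(1) by (intro order_prod_distinct_linear_mult)
  qed
  moreover have "defines_sign_pattern (P t) (Sigma_pattern m n q)"
    by (rule defines_sign_patternI) (use lead deg d' sgn nz in auto)
  ultimately have "degree (P t) + 1 = length (Sigma_pattern m n q) \<and>
      defines_sign_pattern (P t) (Sigma_pattern m n q) \<and>
      card {x. 0 < x \<and> poly (P t) x = 0} = 0 \<and> card {x. x < 0 \<and> poly (P t) x = 0} = d - 2 \<and>
      (\<forall>x. poly (P t) x = 0 \<longrightarrow> order x (P t) = 1)"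
    using pos neg deg d' by (simp only: length_Sigma_pattern) blast
  then show ?thesis
    unfolding realizable_def using sign_pattern_Sigma_pattern[OF assms(1)] by blast
qed

end
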